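(* Let $b \neq 0$ be a real number and let $n \geq 4$ be an integer. Let $A_{(b)}$ and $B$ be the $2n\times 2n$ real skew-symmetric matrices defined in the context, and let $H_{(b)} = (A_{(b)})^2$ and $K = A_{(b)}B + BA_{(b)}$. For $x,y\in\mathbb{R}$ put $L_{(b)}(x,y) = xH_{(b)} + yK$. Then: 1. for all $x,y\in\mathbb{R}$, every eigenvalue of $L_{(b)}(x,y)$ has even multiplicity; 2. $H_{(b)}$ and $K$ generate the full matrix algebra $M_{2n}(\mathbb{C})$ as a $\mathbb{C}$-algebra. Therefore the pair $(H_{(b)},K)$ violates Kippenhahn's Conjecture (as stated in the context).
   Context: Set $$\alpha = \begin{pmatrix}1&0\\0&-1\end{pmatrix},\quad \beta = \begin{pmatrix}0&1\\1&0\end{pmatrix},\quad U=\begin{pmatrix}0&-1\\1&0\end{pmatrix},\qquad q = \frac{n^2}{2}-1 .$$ For $b\in\mathbb{R}$, $A_{(b)}$ is the $2n\times 2n$ real matrix, viewed as an $n\times n$ array of $2\times2$ blocks, with: $(i,i)$ block equal to $(q+i-1)U$ for $1\le i\le n$; $(1,j)$ block equal to $\alpha$ and $(j,1)$ block equal to $-\alpha$ for $2\le j\le n$; $(2,3)$ block equal to $b\alpha+\beta$ and $(3,2)$ block equal to $-b\alpha-\beta$; $(2,4)$ block equal to $b\alpha$ and $(4,2)$ block equal to $-b\alpha$; all other blocks zero. $B$ is the $2n\times 2n$ block diagonal matrix with all $n$ diagonal $2\times 2$ blocks equal to $U$, i.e. $B=I_n\otimes U$. Kippenhahn's Conjecture: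 let $H,K$ be hermitian $2n\times 2n$ matrices, let $f=\det(xH+yK+I)\in\mathbb{R}[x,y]$, and let $\mathcal{A}$ be the algebra generated by $H$ and $K$. If there exist an integer $k\ge 2$ and $g\in\mathbb{C}[x,y]$ with $f=g^k$, then there is a unitary matrix $V$ such that $V^*(xH+yK)V$ is block diagonal (with at least two blocks, the block structure being the same for all $x,y$), and thus $\mathcal{A}\neq M_{2n}(\mathbb{C})$. *)

theory Defs
  imports
    Complex_Main
    "Jordan_Normal_Form.Char_Poly"
    "Jordan_Normal_Form.Schur_Decomposition"
begin

definition alpha_mat :: "real mat" where
  "alpha_mat = mat_of_rows_list 2 [[1, 0], [0, -1]]"

definition beta_mat :: "real mat" where
  "beta_mat = mat_of_rows_list 2 [[0, 1], [1, 0]]"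

definition U_mat :: "real mat" where
  "U_mat = mat_of_rows_list 2 [[0, -1], [1, 0]]"

definition q_val :: "nat \<Rightarrow> real" where
  "q_val n = (real n)^2 / 2 - 1"

text \<open>The function \<open>F\<close> gives the \<open>2 \<times> 2\<close> blocks. Block indices run from \<open>1\<close> to \<open>n\<close>,
  whereas matrix entries are indexed from \<open>0\<close>.\<close>

definition block_array :: "nat \<Rightarrow> (nat \<Rightarrow> nat \<Rightarrow> 'a mat) \<Rightarrow> 'a mat" where
  "block_array n F = mat (2 * n) (2 * n)
     (\<lambda>(r, c). F (r div 2 + 1) (c div 2 + 1) $$ (r mod 2, c mod 2))"

definition A_block :: "real \<Rightarrow> nat \<Rightarrow> nat \<Rightarrow> nat \<Rightarrow> real mat" where
  "A_block b n i j =
    (if i = j then (q_val n + real i - 1) \<cdot>\<^sub>m U_mat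
     else if i = 1 then alpha_mat
     else if j = 1 then - alpha_mat
     else if (i, j) = (2, 3) then b \<cdot>\<^sub>m alpha_mat + beta_mat
     else if (i, j) = (3, 2) then - (b \<cdot>\<^sub>m alpha_mat) - beta_mat
     else if (i, j) = (2, 4) then b \<cdot>\<^sub>m alpha_mat
     else if (i, j) = (4, 2) then - (b \<cdot>\<^sub>m alpha_mat)
     else 0\<^sub>m 2 2)"

definition A_mat :: "real \<Rightarrow> nat \<Rightarrow> real mat" where
  "A_mat b n = block_array n (A_block b n)"

definition B_mat :: "nat \<Rightarrow> real mat" where
  "B_mat n = block_array n (\<lambda>i j. if i = j then U_mat else 0\<^sub>m 2 2)"

definition H_mat :: "real \<Rightarrow> nat \<Rightarrow> complex mat" where
  "H_mat b n = map_mat complex_of_real (A_mat b n * A_mat b n)"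

definition K_mat :: "real \<Rightarrow> nat \<Rightarrow> complex mat" where
  "K_mat b n = map_mat complex_of_real (A_mat b n * B_mat n + B_mat n * A_mat b n)"

definition pencil :: "complex mat \<Rightarrow> complex mat \<Rightarrow> real \<Rightarrow> real \<Rightarrow> complex mat" where
  "pencil H K x y = complex_of_real x \<cdot>\<^sub>m H + complex_of_real y \<cdot>\<^sub>m K"

inductive_set generated_algebra :: "nat \<Rightarrow> complex mat set \<Rightarrow> complex mat set"
  for N :: nat and S :: "complex mat set" where
  gen: "M \<in> S \<Longrightarrow> M \<in> generated_algebra N S"
| one: "1\<^sub>m N \<in> generated_algebra N S"
| add: "M \<in> generated_algebra N S \<Longrightarrow> M' \<in> generated_algebra N S
        \<Longrightarrow> M + M' \<in> generated_algebra N S"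
| smult: "M \<in> generated_algebra N S \<Longrightarrow> c \<cdot>\<^sub>m M \<in> generated_algebra N S"
| mult: "M \<in> generated_algebra N S \<Longrightarrow> M' \<in> generated_algebra N S
        \<Longrightarrow> M * M' \<in> generated_algebra N S"

definition hermitian_mat :: "nat \<Rightarrow> complex mat \<Rightarrow> bool" where
  "hermitian_mat N M \<longleftrightarrow> M \<in> carrier_mat N N \<and> mat_adjoint M = M"

definition unitary_mat :: "nat \<Rightarrow> complex mat \<Rightarrow> bool" where
  "unitary_mat N V \<longleftrightarrow> V \<in> carrier_mat N N \<and>
     mat_adjoint V * V = 1\<^sub>m N \<and> V * mat_adjoint V = 1\<^sub>m N"

text \<open>The ring \<open>\<complex>[x, y]\<close> is represented by \<^typ>\<open>complex poly poly\<close>, where \<open>x\<close> is the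
  variable of the inner and \<open>y\<close> that of the outer polynomial ring. The polynomial
  \<open>det (x H + y K + I)\<close> has real coefficients if \<open>H\<close> and \<open>K\<close> are hermitian.\<close>

definition pencil_poly :: "nat \<Rightarrow> complex mat \<Rightarrow> complex mat \<Rightarrow> complex poly poly" where
  "pencil_poly N H K = det ([:[:0, 1:]:] \<cdot>\<^sub>m map_mat (\<lambda>c. [:[:c:]:]) H
                          + [:0, 1:] \<cdot>\<^sub>m map_mat (\<lambda>c. [:[:c:]:]) K + 1\<^sub>m N)"

definition kippenhahn_hypothesis :: "nat \<Rightarrow> complex mat \<Rightarrow> complex mat \<Rightarrow> bool" where
  "kippenhahn_hypothesis m H K \<longleftrightarrow>
     hermitian_mat (2 * m) H \<and> hermitian_mat (2 * m) K \<and>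
     (\<exists>k::nat. k \<ge> 2 \<and> (\<exists>g. pencil_poly (2 * m) H K = g ^ k))"

text \<open>The list \<open>ds\<close> of block sizes is chosen before \<open>x\<close> and \<open>y\<close>. All blocks are nonempty.\<close>

definition unitarily_block_diagonal :: "nat \<Rightarrow> complex mat \<Rightarrow> complex mat \<Rightarrow> bool" where
  "unitarily_block_diagonal N H K \<longleftrightarrow>
     (\<exists>V ds. unitary_mat N V \<and> length ds \<ge> 2 \<and> (\<forall>d \<in> set ds. d > 0) \<and> sum_list ds = N \<and>
        (\<forall>x y. \<exists>Ms. map dim_row Ms = ds \<and> map dim_col Ms = ds \<and>
           mat_adjoint V * pencil H K x y * V = diag_block_mat Ms))"

text \<open>The conjecture's further conclusion that \<open>H\<close> and \<open>K\<close> do not generate the full matrix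
  algebra follows from block diagonality and is therefore not part of this definition; without
  it the negation is the strongest.\<close>

definition kippenhahn_conjecture_for :: "nat \<Rightarrow> complex mat \<Rightarrow> complex mat \<Rightarrow> bool" where
  "kippenhahn_conjecture_for m H K \<longleftrightarrow>
     (kippenhahn_hypothesis m H K \<longrightarrow> unitarily_block_diagonal (2 * m) H K)"

end

theory Submission
  imports Defs
begin

text \<open>
  Write \<open>A\<close>, \<open>B\<close>, \<open>H = A\<^sup>2\<close> and \<open>K = A B + B A\<close> for the matrices of the statement.

  \<^emph>\<open>Even multiplicities.\<close> Since \<open>B\<^sup>2 = - I\<close>, completing the square gives
  \<open>x (w I + x H + y K) = (x w + y\<^sup>2) I + (x A + y B)\<^sup>2\<close>, and \<open>x A + y B\<close> is skew-symmetric of even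
  order. The characteristic polynomial of a skew-symmetric matrix \<open>M\<close> of even order is even, say
  \<open>r(t\<^sup>2)\<close>, and then the characteristic polynomial of \<open>M\<^sup>2\<close> is \<open>r\<^sup>2\<close>. Hence
  \<open>x\<^bsup>2n\<^esup> det (w I + x H + y K)\<close> is a square. If \<open>x\<close> is a prime element of the coefficient ring, the
  factor \<open>x\<^bsup>2n\<^esup>\<close> can be cancelled, so the determinant itself is a square (\<open>det_pencil_square\<close>).
  With \<open>x\<close> and \<open>y\<close> as the indeterminates this says that \<open>det (x H + y K + I)\<close> is a square. For
  numbers \<open>x\<close>, \<open>y\<close>, where \<open>x\<close> may vanish, \<open>x\<close> is first perturbed to a prime \<open>t - x\<close>,
  and \<open>t\<close> is then set to \<open>0\<close>: the characteristic polynomial of every \<open>x H + y K\<close> is a square.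

  \<^emph>\<open>Generation.\<close> The matrix \<open>U\<close> anticommutes with \<open>\<alpha>\<close> and \<open>\<beta>\<close>. So \<open>K\<close> is block diagonal, and
  its blocks are distinct multiples of the identity. Interpolation
  polynomials in \<open>K\<close> then yield the block projections, and these cut every block of \<open>H\<close> out of
  \<open>H\<close>. The products of the blocks \<open>(1,2)\<close> and \<open>(1,4)\<close> with their transposes
  generate all matrices of order two in the position \<open>(1,1)\<close>; this is where \<open>b \<noteq> 0\<close> enters. The
  blocks \<open>(1,2)\<close>, \<open>(2,3)\<close>, \<open>(3,4)\<close> and \<open>(1,j)\<close> for \<open>j \<ge> 5\<close> are invertible, so they carry these
  matrices to every position of the first block row. The algebra is closed under
  transposition, so it also contains the first block column, hence everything.

  \<^emph>\<open>Kippenhahn's conjecture.\<close> The first part provides the hypothesis with \<open>k = 2\<close>. If the pencil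
  were simultaneously block diagonal in a unitary basis, all of the generated algebra would vanish
  in the upper right block in that basis
  (\<open>full_generated_algebra_not_unitarily_block_diagonal\<close>).
\<close>

section \<open>Determinants that are squares\<close>

lemma even_poly_is_polynomial_in_square:
  fixes p :: "'a::comm_ring_1 poly"
  assumes "\<And>k. odd k \<Longrightarrow> coeff p k = 0"
  shows "\<exists>r. p = pcompose r [:0, 0, 1:]"
  using assms
proof (induction "degree p" arbitrary: p rule: less_induct)
  case less
  obtain a p1 where p: "p = pCons a p1" by (cases p)
  obtain c p2 where p1: "p1 = pCons c p2" by (cases p1)
  have "coeff p (Suc 0) = c" by (simp add: p p1)
  hence c: "c = 0" using less.prems[of "Suc 0"] by simp
  have ev: "coeff p2 k = 0" if "odd k" for k
    using less.prems[of "Suc (Suc k)"] that by (simp add: p p1)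
  show ?case
  proof (cases "p2 = 0")
    case True
    hence "p = pcompose [:a:] [:0, 0, 1:]" by (simp add: p p1 c)
    thus ?thesis by blast
  next
    case False
    hence "degree p2 < degree p" by (simp add: p p1)
    from less.hyps[OF this ev] obtain r where r: "p2 = pcompose r [:0, 0, 1:]" by blast
    have "p = pcompose (pCons a r) [:0, 0, 1:]"
      by (simp add: pcompose_pCons p p1 c r)
    thus ?thesis by blast
  qed
qed

text \<open>Replacing \<open>t\<close> by \<open>- t\<close> in \<open>det (t I - M)\<close> turns the matrix into \<open>- (t I - M\<^sup>T)\<close>, which has the
  same determinant because the order is even.\<close>

lemma char_poly_skew_even:
  fixes M :: "'a::{idom, ring_char_0} mat"
  assumes M: "M \<in> carrier_mat N N" and skew: "M\<^sup>T = - M" and N: "even N"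
  shows "pcompose (char_poly M) [:0, -1:] = char_poly M"
proof -
  have "pcompose (char_poly M) [:0, -1:] = det (map_mat (\<lambda>p. pcompose p [:0, -1:]) (char_poly_matrix M))"
    unfolding char_poly_def by (rule comm_ring_hom.hom_det[OF pcompose_hom.comm_ring_hom_axioms, symmetric])
  also have "map_mat (\<lambda>p. pcompose p [:0, -1:]) (char_poly_matrix M) = (-1) \<cdot>\<^sub>m char_poly_matrix (M\<^sup>T)"
    using M by (intro eq_matI) (auto simp: char_poly_matrix_def skew pcompose_pCons)
  also have "det \<dots> = char_poly M"
    using M N by (simp add: det_smult char_poly_def[symmetric] del: transpose_carrier_mat)
       (simp add: char_poly_matrix_def)
  finally show ?thesis .
qed

text \<open>The factorization \<open>t\<^sup>2 I - M\<^sup>2 = (t I - M) (t I - M\<^sup>T)\<close> shows that the characteristic polynomial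
  of \<open>M\<^sup>2\<close>, evaluated at \<open>t\<^sup>2\<close>, is the square of that of \<open>M\<close>. The latter is even, so it is
  itself a polynomial in \<open>t\<^sup>2\<close>, and substitution of \<open>t\<^sup>2\<close> is injective.\<close>

lemma char_poly_skew_square:
  fixes M :: "'a::{idom, ring_char_0} mat"
  assumes M: "M \<in> carrier_mat N N" and skew: "M\<^sup>T = - M" and N: "even N"
  shows "\<exists>r. char_poly (M * M) = r\<^sup>2"
proof -
  let ?p = "char_poly M"
  have "coeff ?p k = 0" if "odd k" for k
  proof -
    have "coeff ?p k = (-1) ^ k * coeff ?p k"
      using coeff_pcompose_linear[of ?p "-1" k] unfolding char_poly_skew_even[OF assms] .
    also have "\<dots> = - coeff ?p k" using that by simp
    finally have "2 * coeff ?p k = 0" unfolding eq_neg_iff_add_eq_0 mult_2 .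
    thus ?thesis by simp
  qed
  from even_poly_is_polynomial_in_square[OF this]
  obtain r where r: "?p = pcompose r [:0, 0, 1:]" by blast
  let ?X = "[:0, 1:] \<cdot>\<^sub>m 1\<^sub>m N :: 'a poly mat"
  let ?c = "map_mat (\<lambda>a. [:a:])"
  interpret c: comm_ring_hom "\<lambda>a::'a. [:a:]" by standard auto
  have cM: "?c M \<in> carrier_mat N N" using M by simp
  have MM: "?c (M * M) = ?c M * ?c M"
    by (rule c.mat_hom_mult[OF M M])
  have "pcompose (char_poly (M * M)) [:0, 0, 1:]
      = det (map_mat (\<lambda>p. pcompose p [:0, 0, 1:]) (char_poly_matrix (M * M)))"
    unfolding char_poly_def by (rule comm_ring_hom.hom_det[OF pcompose_hom.comm_ring_hom_axioms, symmetric])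
  also have "map_mat (\<lambda>p. pcompose p [:0, 0, 1:]) (char_poly_matrix (M * M))
     = [:0, 0, 1:] \<cdot>\<^sub>m 1\<^sub>m N - ?c (M * M)"
    using M by (intro eq_matI) (auto simp: char_poly_matrix_def pcompose_pCons)
  also have "\<dots> = (?X - ?c M) * (?X + ?c M)"
  proof -
    have X: "?X \<in> carrier_mat N N" by simp
    have XM: "?X * ?c M = [:0, 1:] \<cdot>\<^sub>m ?c M" "?c M * ?X = [:0, 1:] \<cdot>\<^sub>m ?c M"
      unfolding mult_smult_assoc_mat[OF one_carrier_mat cM] mult_smult_distrib[OF cM one_carrier_mat]
        left_mult_one_mat[OF cM] right_mult_one_mat[OF cM] by (rule refl)+
    have XX: "?X * ?X = [:0, 0, 1:] \<cdot>\<^sub>m 1\<^sub>m N"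
      unfolding mult_smult_assoc_mat[OF one_carrier_mat X] left_mult_one_mat[OF X]
      by (intro eq_matI) auto
    have "(?X - ?c M) * (?X + ?c M) = ?X * ?X + ?X * ?c M - (?c M * ?X + ?c M * ?c M)"
      unfolding minus_mult_distrib_mat[OF X cM add_carrier_mat[OF cM]]
        mult_add_distrib_mat[OF X X cM] mult_add_distrib_mat[OF cM X cM] by (rule refl)
    also have "\<dots> = [:0, 0, 1:] \<cdot>\<^sub>m 1\<^sub>m N - ?c (M * M)"
    proof -
      have add_sub: "P + Q - (Q + R) = P - R"
        if "P \<in> carrier_mat N N" "Q \<in> carrier_mat N N" "R \<in> carrier_mat N N"
        for P Q R :: "'a poly mat"
        using that by (intro eq_matI) auto
      show ?thesis unfolding XX XM MM by (rule add_sub) (use cM in auto)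
    qed
    finally show ?thesis by (rule sym)
  qed
  also have "det \<dots> = det (?X - ?c M) * det (?X + ?c M)"
    by (rule det_mult[of _ N]) (use cM in auto)
  also have "?X - ?c M = char_poly_matrix M"
    using M by (intro eq_matI) (auto simp: char_poly_matrix_def)
  also have "?X + ?c M = char_poly_matrix (M\<^sup>T)"
    using M by (intro eq_matI) (auto simp: char_poly_matrix_def skew)
  finally have "pcompose (char_poly (M * M)) [:0, 0, 1:] = ?p * ?p"
    using M by (simp add: char_poly_def[symmetric] del: transpose_carrier_mat)
  hence "pcompose (char_poly (M * M) - r * r) [:0, 0, 1:] = 0"
    using r by (simp add: pcompose_diff pcompose_mult)
  hence "char_poly (M * M) - r * r = 0"
    by (rule pcompose_eq_0) simp
  thus ?thesis by (auto simp: power2_eq_square)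
qed

lemma det_scalar_plus_skew_square:
  fixes M :: "'a::{idom, ring_char_0} mat"
  assumes M: "M \<in> carrier_mat N N" and skew: "M\<^sup>T = - M" and N: "even N"
  shows "\<exists>r. det (s \<cdot>\<^sub>m 1\<^sub>m N + M * M) = r\<^sup>2"
proof -
  obtain r where r: "char_poly (M * M) = r\<^sup>2"
    using char_poly_skew_square[OF assms] by blast
  have "poly (char_poly (M * M)) (- s) = det ((-1) \<cdot>\<^sub>m (s \<cdot>\<^sub>m 1\<^sub>m N + M * M))"
    unfolding char_poly_def
    by (rule poly_det_cong[of _ N]) (use M in \<open>auto simp: char_poly_matrix_def\<close>)
  also have "\<dots> = det (s \<cdot>\<^sub>m 1\<^sub>m N + M * M)"
    using M N by simp
  finally show ?thesis unfolding r by (metis poly_power)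
qed

lemma prime_elem_monic_linear_poly: "prime_elem [:- a, 1 :: 'a::idom:]"
proof (rule prime_elemI)
  show "\<not> [:- a, 1:] dvd 1" unfolding poly_eq_0_iff_dvd[symmetric] by simp
  fix p q :: "'a poly" assume "[:- a, 1:] dvd p * q"
  thus "[:- a, 1:] dvd p \<or> [:- a, 1:] dvd q" unfolding poly_eq_0_iff_dvd[symmetric] by simp
qed simp

text \<open>Division by one factor \<open>x\<^sup>2\<close> at a time: a prime that divides \<open>r\<^sup>2\<close> divides \<open>r\<close>.\<close>

lemma prime_power_cofactor_of_square:
  fixes x :: "'a::idom"
  assumes x: "prime_elem x" and "x ^ (2 * m) * d = r\<^sup>2"
  shows "\<exists>g. d = g\<^sup>2"
  using assms(2)
proof (induction m arbitrary: r)
  case 0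
  thus ?case by auto
next
  case (Suc m)
  have "x dvd r\<^sup>2" using Suc.prems by (metis dvd_mult2 dvd_triv_left mult_Suc_right power_add power2_eq_square)
  hence "x dvd r" using x prime_elem_dvd_power by blast
  then obtain r' where r: "r = x * r'" by blast
  have "x ^ 2 * (x ^ (2 * m) * d) = x ^ 2 * r'\<^sup>2"
    using Suc.prems by (simp add: r power_mult_distrib algebra_simps power2_eq_square)
  hence "x ^ (2 * m) * d = r'\<^sup>2" using x by (simp add: prime_elem_def)
  thus ?case by (rule Suc.IH)
qed

text \<open>After multiplication by \<open>x\<close> the matrix becomes a scalar matrix plus \<open>(x A + y B)\<^sup>2\<close>. Primality of
  \<open>x\<close> serves to undo this multiplication.\<close>

lemma det_pencil_square:
  fixes A B :: "'a::{idom, ring_char_0} mat"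
  assumes A: "A \<in> carrier_mat (2 * m) (2 * m)" "A\<^sup>T = - A"
    and B: "B \<in> carrier_mat (2 * m) (2 * m)" "B\<^sup>T = - B" "B * B = - 1\<^sub>m (2 * m)"
    and x: "prime_elem x"
  shows "\<exists>g. det (w \<cdot>\<^sub>m 1\<^sub>m (2 * m) + x \<cdot>\<^sub>m (A * A) + y \<cdot>\<^sub>m (A * B + B * A)) = g\<^sup>2"
proof -
  let ?N = "2 * m"
  let ?L = "w \<cdot>\<^sub>m 1\<^sub>m ?N + x \<cdot>\<^sub>m (A * A) + y \<cdot>\<^sub>m (A * B + B * A)"
  define M where "M = x \<cdot>\<^sub>m A + y \<cdot>\<^sub>m B"
  have dims: "dim_row A = 2 * m" "dim_col A = 2 * m" "dim_row B = 2 * m" "dim_col B = 2 * m"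
    using A B by auto
  have M: "M \<in> carrier_mat ?N ?N" using A B by (simp add: M_def)
  have entry: "A $$ (j, i) = - A $$ (i, j)" "B $$ (j, i) = - B $$ (i, j)"
    if "i < ?N" "j < ?N" for i j
    using arg_cong[OF A(2), of "\<lambda>Z. Z $$ (i, j)"] arg_cong[OF B(2), of "\<lambda>Z. Z $$ (i, j)"] that dims
    by auto
  have skew: "M\<^sup>T = - M"
  proof (rule eq_matI)
    fix i j assume "i < dim_row (- M)" "j < dim_col (- M)"
    hence "i < ?N" "j < ?N" using M by auto
    thus "M\<^sup>T $$ (i, j) = (- M) $$ (i, j)"
      using entry[of i j] dims by (simp add: M_def)
  qed (use M in auto)
  have "M * M = (x * x) \<cdot>\<^sub>m (A * A) + (x * y) \<cdot>\<^sub>m (A * B + B * A) + (y * y) \<cdot>\<^sub>m (B * B)"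
  proof -
    have "M * M = (x \<cdot>\<^sub>m A) * (x \<cdot>\<^sub>m A) + (y \<cdot>\<^sub>m B) * (x \<cdot>\<^sub>m A)
        + ((x \<cdot>\<^sub>m A) * (y \<cdot>\<^sub>m B) + (y \<cdot>\<^sub>m B) * (y \<cdot>\<^sub>m B))"
    proof -
      have xA: "x \<cdot>\<^sub>m A \<in> carrier_mat ?N ?N" and yB: "y \<cdot>\<^sub>m B \<in> carrier_mat ?N ?N"
        using A B by auto
      show ?thesis
        unfolding M_def mult_add_distrib_mat[OF add_carrier_mat[OF yB] xA yB]
          add_mult_distrib_mat[OF xA yB xA] add_mult_distrib_mat[OF xA yB yB] ..
    qed
    thus ?thesis using A B
      by (simp add: mult_smult_assoc_mat[of _ ?N ?N] mult_smult_distrib[of _ ?N ?N])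
         (intro eq_matI, auto simp: algebra_simps)
  qed
  hence eq: "x \<cdot>\<^sub>m ?L = (x * w + y * y) \<cdot>\<^sub>m 1\<^sub>m ?N + M * M"
    unfolding B(3) using A(1) B(1) by (intro eq_matI) (auto simp: algebra_simps)
  obtain r where "det (x \<cdot>\<^sub>m ?L) = r\<^sup>2"
    unfolding eq using det_scalar_plus_skew_square[OF M skew] by auto
  moreover have "det (x \<cdot>\<^sub>m ?L) = x ^ ?N * det ?L"
    using dims by simp
  ultimately show ?thesis
    using prime_power_cofactor_of_square[OF x] by metis
qed

section \<open>Matrices of order two\<close>

abbreviation mat2 :: "'a \<Rightarrow> 'a \<Rightarrow> 'a \<Rightarrow> 'a \<Rightarrow> 'a mat" where
  "mat2 a b c d \<equiv> mat_of_rows_list 2 [[a, b], [c, d]]"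

lemma mat2_dim [simp]: "dim_row (mat2 a b c d) = 2" "dim_col (mat2 a b c d) = 2"
  by (simp_all add: mat_of_rows_list_def)

lemma mat2_carrier [simp]: "mat2 a b c d \<in> carrier_mat 2 2"
  by (rule carrier_matI) simp_all

lemma mat2_index [simp]:
  "mat2 a b c d $$ (0, 0) = a" "mat2 a b c d $$ (0, Suc 0) = b"
  "mat2 a b c d $$ (Suc 0, 0) = c" "mat2 a b c d $$ (Suc 0, Suc 0) = d"
  by (simp_all add: mat_of_rows_list_def)

lemma mat2_eqI:
  assumes "X \<in> carrier_mat 2 2" "X $$ (0, 0) = a" "X $$ (0, 1) = b" "X $$ (1, 0) = c" "X $$ (1, 1) = d"
  shows "X = mat2 a b c d"
  using assms by (intro eq_matI) (auto simp: less_2_cases_iff)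

lemma sum_upto_2: "(\<Sum>i = 0..<2. f i) = f 0 + f (Suc 0)"
  by (simp add: numeral_2_eq_2)

lemma mat2_mult:
  fixes a :: "'a::comm_ring_1"
  shows "mat2 a b c d * mat2 a' b' c' d'
    = mat2 (a * a' + b * c') (a * b' + b * d') (c * a' + d * c') (c * b' + d * d')"
  by (rule mat2_eqI) (auto simp: scalar_prod_def sum_upto_2)

lemma mat2_linear:
  fixes a :: "'a::comm_ring_1"
  shows "mat2 a b c d + mat2 a' b' c' d' = mat2 (a + a') (b + b') (c + c') (d + d')"
    and "mat2 a b c d - mat2 a' b' c' d' = mat2 (a - a') (b - b') (c - c') (d - d')"
    and "- mat2 a b c d = mat2 (- a) (- b) (- c) (- d)"
    and "s \<cdot>\<^sub>m mat2 a b c d = mat2 (s * a) (s * b) (s * c) (s * d)"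
    and "0\<^sub>m 2 2 = mat2 0 0 0 (0::'a)"
    and "1\<^sub>m 2 = mat2 1 0 0 (1::'a)"
    and "(mat2 a b c d)\<^sup>T = mat2 a c b d"
  by (rule mat2_eqI; auto)+

lemma map_mat_mat2: "map_mat f (mat2 a b c d) = mat2 (f a) (f b) (f c) (f d)"
  by (rule mat2_eqI) auto

lemma mat2_left_inverse:
  fixes a :: "'a::field"
  assumes "a * d - b * c \<noteq> 0"
  shows "\<exists>Z \<in> carrier_mat 2 2. Z * mat2 a b c d = 1\<^sub>m 2"
proof -
  define D where "D = a * d - b * c"
  have D: "D \<noteq> 0" using assms by (simp add: D_def)
  have "(1 / D) \<cdot>\<^sub>m mat2 d (- b) (- c) a * mat2 a b c d
      = (1 / D) \<cdot>\<^sub>m mat2 D 0 0 D"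
    unfolding mult_smult_assoc_mat[OF mat2_carrier mat2_carrier] mat2_mult
    by (simp add: D_def algebra_simps)
  also have "\<dots> = 1\<^sub>m 2"
    unfolding mat2_linear using D by simp
  finally have "(1 / D) \<cdot>\<^sub>m mat2 d (- b) (- c) a * mat2 a b c d = 1\<^sub>m 2" .
  thus ?thesis by (intro bexI) auto
qed

section \<open>Block matrices\<close>

text \<open>The sum is formed entrywise, because the type of matrices of all sizes has no common zero, which
  \<open>\<Sum>\<close> would require.\<close>

definition block_sum :: "nat set \<Rightarrow> (nat \<Rightarrow> 'a::comm_monoid_add mat) \<Rightarrow> 'a mat" where
  "block_sum T P = mat 2 2 (\<lambda>(a, c). \<Sum>k\<in>T. P k $$ (a, c))"

lemma block_sum_carrier [simp]: "block_sum T P \<in> carrier_mat 2 2"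
  by (simp add: block_sum_def)

lemma block_sum_empty [simp]: "block_sum {} P = 0\<^sub>m 2 2"
  by (intro eq_matI) (auto simp: block_sum_def)

lemma block_sum_insert:
  assumes "finite T" "k \<notin> T" "P k \<in> carrier_mat 2 2"
  shows "block_sum (insert k T) P = P k + block_sum T P"
  using assms by (intro eq_matI) (auto simp: block_sum_def)

lemma block_sum_restrict:
  assumes "finite T" "T' \<subseteq> T" "\<And>k. k \<in> T - T' \<Longrightarrow> P k = 0\<^sub>m 2 2"
  shows "block_sum T P = block_sum T' P"
  using assms unfolding block_sum_def
  by (intro cong_mat) (auto intro!: sum.mono_neutral_right)

lemma block_sum_single:
  assumes "finite T" "k \<in> T" "P k \<in> carrier_mat 2 2"
    and "\<And>l. l \<in> T \<Longrightarrow> l \<noteq> k \<Longrightarrow> P l = 0\<^sub>m 2 2"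
  shows "block_sum T P = P k"
proof -
  have "block_sum T P = block_sum {k} P"
    using assms by (intro block_sum_restrict) auto
  also have "\<dots> = P k"
    using assms block_sum_insert[of "{}" k P] by simp
  finally show ?thesis .
qed

lemma block_array_carrier [simp]: "block_array n F \<in> carrier_mat (2 * n) (2 * n)"
  by (simp add: block_array_def)

lemma block_array_dim [simp]:
  "dim_row (block_array n F) = 2 * n" "dim_col (block_array n F) = 2 * n"
  by (simp_all add: block_array_def)

lemma block_array_index:
  "r < 2 * n \<Longrightarrow> c < 2 * n \<Longrightarrow>
    block_array n F $$ (r, c) = F (r div 2 + 1) (c div 2 + 1) $$ (r mod 2, c mod 2)"
  by (simp add: block_array_def)

lemma block_index_range: "(r::nat) < 2 * n \<Longrightarrow> r div 2 + 1 \<in> {1..n}"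
  by auto

lemma block_array_cong:
  assumes "\<And>i j. i \<in> {1..n} \<Longrightarrow> j \<in> {1..n} \<Longrightarrow> F i j = G i j"
  shows "block_array n F = block_array n G"
  by (intro eq_matI)
     (simp_all add: block_array_index assms[OF block_index_range block_index_range] del: One_nat_def)

lemma block_array_transpose:
  assumes "\<And>i j. F i j \<in> carrier_mat 2 2"
  shows "(block_array n F)\<^sup>T = block_array n (\<lambda>i j. (F j i)\<^sup>T)"
  using carrier_matD[OF assms] by (intro eq_matI) (auto simp: block_array_index)

lemma block_array_uminus:
  assumes "\<And>i j. F i j \<in> carrier_mat 2 2"
  shows "- block_array n F = block_array n (\<lambda>i j. - F i j)"
  using carrier_matD[OF assms] by (intro eq_matI) (auto simp: block_array_index)

lemma block_array_add:
  assumes "\<And>i j. F i j \<in> carrier_mat 2 2" "\<And>i j. G i j \<in> carrier_mat 2 2"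
  shows "block_array n F + block_array n G = block_array n (\<lambda>i j. F i j + G i j)"
  using carrier_matD[OF assms(1)] carrier_matD[OF assms(2)]
  by (intro eq_matI) (auto simp: block_array_index)

lemma block_array_smult:
  assumes "\<And>i j. F i j \<in> carrier_mat 2 2"
  shows "s \<cdot>\<^sub>m block_array n F = block_array n (\<lambda>i j. s \<cdot>\<^sub>m F i j)"
  using carrier_matD[OF assms] by (intro eq_matI) (auto simp: block_array_index)

lemma block_array_map:
  assumes "\<And>i j. F i j \<in> carrier_mat 2 2"
  shows "map_mat f (block_array n F) = block_array n (\<lambda>i j. map_mat f (F i j))"
  using carrier_matD[OF assms] by (intro eq_matI) (auto simp: block_array_index)

lemma sum_div_mod_2:
  fixes f :: "nat \<Rightarrow> nat \<Rightarrow> 'a::comm_monoid_add"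
  shows "(\<Sum>s<2 * n. f (s div 2) (s mod 2)) = (\<Sum>k<n. f k 0 + f k 1)"
  by (induction n) (simp_all add: add.assoc)

lemma block_array_mult:
  fixes F G :: "nat \<Rightarrow> nat \<Rightarrow> 'a::comm_ring_1 mat"
  assumes F: "\<And>i j. F i j \<in> carrier_mat 2 2" and G: "\<And>i j. G i j \<in> carrier_mat 2 2"
  shows "block_array n F * block_array n G
    = block_array n (\<lambda>i j. block_sum {1..n} (\<lambda>k. F i k * G k j))"
proof (rule eq_matI)
  fix r c
  assume "r < dim_row (block_array n (\<lambda>i j. block_sum {1..n} (\<lambda>k. F i k * G k j)))"
    "c < dim_col (block_array n (\<lambda>i j. block_sum {1..n} (\<lambda>k. F i k * G k j)))"
  hence rc: "r < 2 * n" "c < 2 * n" by auto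
  let ?i = "r div 2 + 1" and ?j = "c div 2 + 1" and ?a = "r mod 2" and ?d = "c mod 2"
  have "(block_array n F * block_array n G) $$ (r, c)
      = (\<Sum>s<2 * n. F ?i (s div 2 + 1) $$ (?a, s mod 2) * G (s div 2 + 1) ?j $$ (s mod 2, ?d))"
    using rc by (simp add: scalar_prod_def block_array_index lessThan_atLeast0)
  also have "\<dots> = (\<Sum>k<n. F ?i (k + 1) $$ (?a, 0) * G (k + 1) ?j $$ (0, ?d)
                    + F ?i (k + 1) $$ (?a, 1) * G (k + 1) ?j $$ (1, ?d))"
    by (rule sum_div_mod_2)
  also have "\<dots> = (\<Sum>k<n. (F ?i (k + 1) * G (k + 1) ?j) $$ (?a, ?d))"
    using carrier_matD[OF F] carrier_matD[OF G]
    by (intro sum.cong) (auto simp: scalar_prod_def sum_upto_2)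
  also have "\<dots> = (\<Sum>k=1..n. (F ?i k * G k ?j) $$ (?a, ?d))"
    by (simp add: sum.atLeast1_atMost_eq)
  finally show "(block_array n F * block_array n G) $$ (r, c)
      = block_array n (\<lambda>i j. block_sum {1..n} (\<lambda>k. F i k * G k j)) $$ (r, c)"
    using rc by (simp add: block_array_index block_sum_def)
qed auto

definition block_diagonal :: "nat \<Rightarrow> (nat \<Rightarrow> 'a::comm_ring_1 mat) \<Rightarrow> 'a mat" where
  "block_diagonal n D = block_array n (\<lambda>i j. if i = j then D i else 0\<^sub>m 2 2)"

lemma block_diagonal_mult_left:
  assumes D: "\<And>i. D i \<in> carrier_mat 2 2" and F: "\<And>i j. F i j \<in> carrier_mat 2 2"
  shows "block_diagonal n D * block_array n F = block_array n (\<lambda>i j. D i * F i j)"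
proof -
  have DF: "D i * F i j \<in> carrier_mat 2 2" and 0: "0\<^sub>m 2 2 * F i j = 0\<^sub>m 2 2" for i j
    using mult_carrier_mat[OF D F] left_mult_zero_mat[OF F] by auto
  have "block_sum {1..n} (\<lambda>k. (if i = k then D i else 0\<^sub>m 2 2) * F k j) = D i * F i j"
    if "i \<in> {1..n}" for i j
    using that DF 0
    by (subst block_sum_single[of _ i]) auto
  thus ?thesis unfolding block_diagonal_def using D F
    by (subst block_array_mult) (auto intro!: block_array_cong)
qed

lemma block_diagonal_mult_right:
  assumes D: "\<And>i. D i \<in> carrier_mat 2 2" and F: "\<And>i j. F i j \<in> carrier_mat 2 2"
  shows "block_array n F * block_diagonal n D = block_array n (\<lambda>i j. F i j * D j)"
proof -
  have FD: "F i j * D j \<in> carrier_mat 2 2" and 0: "F i j * 0\<^sub>m 2 2 = 0\<^sub>m 2 2" for i j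
    using mult_carrier_mat[OF F D] right_mult_zero_mat[OF F] by auto
  have "block_sum {1..n} (\<lambda>k. F i k * (if k = j then D k else 0\<^sub>m 2 2)) = F i j * D j"
    if "j \<in> {1..n}" for i j
    using that FD 0
    by (subst block_sum_single[of _ j]) auto
  thus ?thesis unfolding block_diagonal_def using D F
    by (subst block_array_mult) (auto intro!: block_array_cong)
qed

lemma block_diagonal_one: "block_diagonal n (\<lambda>_. 1\<^sub>m 2) = 1\<^sub>m (2 * n)"
proof (rule eq_matI)
  fix r c assume rc: "r < dim_row (1\<^sub>m (2 * n) :: 'a mat)" "c < dim_col (1\<^sub>m (2 * n) :: 'a mat)"
  have "r = c \<longleftrightarrow> r div 2 = c div 2 \<and> r mod 2 = c mod 2"
    by (metis div_mult_mod_eq)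
  thus "block_diagonal n (\<lambda>_. 1\<^sub>m 2) $$ (r, c) = (1\<^sub>m (2 * n) :: 'a mat) $$ (r, c)"
    using rc by (auto simp: block_diagonal_def block_array_index)
qed (auto simp: block_diagonal_def)

text \<open>The Kronecker product of a matrix unit with \<open>X\<close>.\<close>

definition unit_block :: "nat \<Rightarrow> nat \<Rightarrow> nat \<Rightarrow> 'a::comm_ring_1 mat \<Rightarrow> 'a mat" where
  "unit_block n i j X = block_array n (\<lambda>k l. if k = i \<and> l = j then X else 0\<^sub>m 2 2)"

lemma unit_block_mult:
  assumes X: "X \<in> carrier_mat 2 2" and Y: "Y \<in> carrier_mat 2 2" and j: "j \<in> {1..n}"
  shows "unit_block n i j X * unit_block n j k Y = unit_block n i k (X * Y)"
proof -
  have "block_sum {1..n} (\<lambda>s. (if r = i \<and> s = j then X else 0\<^sub>m 2 2) * (if s = j \<and> c = k then Y else 0\<^sub>m 2 2))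
     = (if r = i \<and> c = k then X * Y else 0\<^sub>m 2 2)" for r c
    using j X Y by (subst block_sum_single[of _ j]) auto
  thus ?thesis unfolding unit_block_def using X Y by (subst block_array_mult) auto
qed

lemma unit_block_add:
  assumes X: "X \<in> carrier_mat 2 2" and Y: "Y \<in> carrier_mat 2 2"
  shows "unit_block n i j X + unit_block n i j Y = unit_block n i j (X + Y)"
  unfolding unit_block_def using X Y
  by (subst block_array_add) (auto intro!: block_array_cong)

lemma unit_block_smult:
  assumes X: "X \<in> carrier_mat 2 2"
  shows "s \<cdot>\<^sub>m unit_block n i j X = unit_block n i j (s \<cdot>\<^sub>m X)"
  unfolding unit_block_def using X
  by (subst block_array_smult) (auto intro!: block_array_cong)

lemma unit_block_transpose:
  assumes X: "X \<in> carrier_mat 2 2"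
  shows "(unit_block n i j X)\<^sup>T = unit_block n j i (X\<^sup>T)"
  unfolding unit_block_def using X
  by (subst block_array_transpose) (auto intro!: block_array_cong)

text \<open>The outer factors are the projections to the block rows \<open>i\<close> and \<open>j\<close>.\<close>

lemma unit_block_compression:
  assumes F: "\<And>i j. F i j \<in> carrier_mat 2 2"
  shows "block_diagonal n (\<lambda>k. (if k = i then 1 else 0) \<cdot>\<^sub>m 1\<^sub>m 2) * block_array n F
     * block_diagonal n (\<lambda>k. (if k = j then 1 else 0) \<cdot>\<^sub>m 1\<^sub>m 2) = unit_block n i j (F i j)"
proof -
  have 0: "0 \<cdot>\<^sub>m 1\<^sub>m 2 = (0\<^sub>m 2 2 :: 'a mat)" by (intro eq_matI) auto
  have 1: "1 \<cdot>\<^sub>m 1\<^sub>m 2 = (1\<^sub>m 2 :: 'a mat)" by (intro eq_matI) auto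
  show ?thesis
    unfolding unit_block_def
    by (subst block_diagonal_mult_left; (subst block_diagonal_mult_right)?)
       (auto intro!: block_array_cong mult_carrier_mat[of _ _ 2] F
         simp: 0 1 left_mult_one_mat[OF F] right_mult_one_mat[OF F]
           left_mult_zero_mat[OF F] right_mult_zero_mat[OF F])
qed

text \<open>The Kronecker product of a diagonal matrix with the identity of order two. These matrices form a
  copy of the ring of functions on \<open>{1..n}\<close>.\<close>

definition scalar_blocks :: "nat \<Rightarrow> (nat \<Rightarrow> 'a::comm_ring_1) \<Rightarrow> 'a mat" where
  "scalar_blocks n f = block_diagonal n (\<lambda>i. f i \<cdot>\<^sub>m 1\<^sub>m 2)"

lemma smult_zero_mat [simp]: "s \<cdot>\<^sub>m 0\<^sub>m m k = (0\<^sub>m m k :: 'a::semiring_1 mat)"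
  by (intro eq_matI) auto

lemma scalar_blocks_carrier: "scalar_blocks n f \<in> carrier_mat (2 * n) (2 * n)"
  by (simp add: scalar_blocks_def block_diagonal_def)

lemma scalar_blocks_mult: "scalar_blocks n f * scalar_blocks n g = scalar_blocks n (\<lambda>i. f i * g i)"
proof -
  have "scalar_blocks n f * scalar_blocks n g
      = block_array n (\<lambda>i j. f i \<cdot>\<^sub>m 1\<^sub>m 2 * (if i = j then g i \<cdot>\<^sub>m 1\<^sub>m 2 else 0\<^sub>m 2 2))"
    unfolding scalar_blocks_def block_diagonal_def[of n "\<lambda>i. g i \<cdot>\<^sub>m 1\<^sub>m 2"]
    by (rule block_diagonal_mult_left) auto
  also have "\<dots> = scalar_blocks n (\<lambda>i. f i * g i)"
    unfolding scalar_blocks_def block_diagonal_def mat2_linear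
    by (rule block_array_cong) (simp add: mat2_mult)
  finally show ?thesis .
qed

lemma scalar_blocks_smult: "c \<cdot>\<^sub>m scalar_blocks n f = scalar_blocks n (\<lambda>i. c * f i)"
  unfolding scalar_blocks_def block_diagonal_def
  by (subst block_array_smult) (auto intro!: block_array_cong eq_matI)

lemma scalar_blocks_add: "scalar_blocks n f + scalar_blocks n g = scalar_blocks n (\<lambda>i. f i + g i)"
  unfolding scalar_blocks_def block_diagonal_def
  by (subst block_array_add)
     (auto simp: add_smult_distrib_right_mat[OF one_carrier_mat] intro!: block_array_cong)

lemma scalar_blocks_one: "scalar_blocks n (\<lambda>_. 1) = 1\<^sub>m (2 * n)"
  unfolding scalar_blocks_def block_diagonal_one[symmetric]
  by (rule arg_cong[of _ _ "block_diagonal n"]) (auto intro!: eq_matI)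

lemma scalar_blocks_diff_const:
  "scalar_blocks n f + (- c) \<cdot>\<^sub>m 1\<^sub>m (2 * n) = scalar_blocks n (\<lambda>i. f i - c)"
  unfolding scalar_blocks_one[symmetric] scalar_blocks_smult scalar_blocks_add by simp

lemma scalar_blocks_transpose: "(scalar_blocks n f)\<^sup>T = scalar_blocks n f"
  unfolding scalar_blocks_def block_diagonal_def
  by (subst block_array_transpose, simp, rule block_array_cong) (auto simp: mat2_linear)

lemma unit_block_one: "unit_block n i i (1\<^sub>m 2) = scalar_blocks n (\<lambda>l. if l = i then 1 else 0)"
  unfolding unit_block_def scalar_blocks_def block_diagonal_def
  by (rule block_array_cong) (auto simp: mat2_linear)

section \<open>Generated matrix algebras\<close>

lemma generated_algebra_carrier:
  assumes "S \<subseteq> carrier_mat N N" "M \<in> generated_algebra N S"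
  shows "M \<in> carrier_mat N N"
  using assms(2) by induction (use assms(1) in auto)

lemma generated_algebra_transpose:
  assumes S: "S \<subseteq> carrier_mat N N" and sym: "\<And>M. M \<in> S \<Longrightarrow> M\<^sup>T \<in> generated_algebra N S"
    and "M \<in> generated_algebra N S"
  shows "M\<^sup>T \<in> generated_algebra N S"
  using assms(3)
proof induction
  case (gen M)
  thus ?case by (rule sym)
next
  case one
  thus ?case by (simp add: generated_algebra.one)
next
  case (add M M')
  thus ?case using generated_algebra_carrier[OF S]
    by (simp add: transpose_add[of _ N N] generated_algebra.add)
next
  case (smult M c)
  have "(c \<cdot>\<^sub>m M)\<^sup>T = c \<cdot>\<^sub>m M\<^sup>T" by (intro eq_matI) auto
  thus ?case using smult by (simp add: generated_algebra.smult)
next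
  case (mult M M')
  have "(M * M')\<^sup>T = M'\<^sup>T * M\<^sup>T"
    using mult.hyps[THEN generated_algebra_carrier[OF S]] by (rule transpose_mult)
  thus ?case using mult.IH by (simp add: generated_algebra.mult)
qed

lemma generated_algebra_zero: "0\<^sub>m N N \<in> generated_algebra N S"
proof -
  have "0\<^sub>m N N = (0::complex) \<cdot>\<^sub>m 1\<^sub>m N" by (intro eq_matI) auto
  thus ?thesis using generated_algebra.smult[OF generated_algebra.one] by metis
qed

text \<open>A function on a finite set that separates points generates all functions on that set: the indicator
  of a point is a Lagrange interpolation polynomial in \<open>k\<close>.\<close>

lemma block_projection_in_generated_algebra:
  assumes k: "scalar_blocks n k \<in> generated_algebra (2 * n) S"
    and inj: "inj_on k {1..n}" and i: "i \<in> {1..n}"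
  shows "scalar_blocks n (\<lambda>l. if l = i then 1 else 0) \<in> generated_algebra (2 * n) S"
proof -
  \<comment> \<open>Products of the factors \<open>K - k\<^sub>j I\<close>; for \<open>T = {1..n} - {i}\<close> only block \<open>i\<close> survives.\<close>
  have prods: "scalar_blocks n (\<lambda>l. \<Prod>j\<in>T. k l - k j) \<in> generated_algebra (2 * n) S"
    if "finite T" for T
    using that
  proof induction
    case empty
    show ?case by (simp add: scalar_blocks_one generated_algebra.one)
  next
    case (insert t T)
    have "scalar_blocks n (\<lambda>l. k l - k t) \<in> generated_algebra (2 * n) S"
      using generated_algebra.add[OF k generated_algebra.smult[OF generated_algebra.one, where c = "- k t"]]
      by (simp only: scalar_blocks_diff_const)
    from generated_algebra.mult[OF this insert.IH]
    show ?case by (simp only: scalar_blocks_mult prod.insert[OF insert.hyps])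
  qed
  let ?T = "{1..n} - {i}"
  define c where "c = (\<Prod>j\<in>?T. k i - k j)"
  have c: "c \<noteq> 0"
    unfolding c_def using inj_onD[OF inj _ i] by fastforce
  have "scalar_blocks n (\<lambda>l. if l = i then 1 else 0)
      = scalar_blocks n (\<lambda>l. (1 / c) * (\<Prod>j\<in>?T. k l - k j))"
    unfolding scalar_blocks_def block_diagonal_def
  proof (rule block_array_cong)
    fix l j assume l: "l \<in> {1..n}"
    have "(if l = i then 1 else 0) = (1 / c) * (\<Prod>j\<in>?T. k l - k j)"
    proof (cases "l = i")
      case True
      show ?thesis unfolding True c_def[symmetric] using c by simp
    next
      case False
      hence "(\<Prod>j\<in>?T. k l - k j) = 0" using l by (intro prod_zero) auto
      thus ?thesis using False by simp
    qed
    thus "(if l = j then (if l = i then 1 else 0) \<cdot>\<^sub>m 1\<^sub>m 2 else 0\<^sub>m 2 2)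
      = (if l = j then ((1 / c) * (\<Prod>j\<in>?T. k l - k j)) \<cdot>\<^sub>m 1\<^sub>m 2 else 0\<^sub>m 2 2)"
      by (simp only:)
  qed
  also have "\<dots> = (1 / c) \<cdot>\<^sub>m scalar_blocks n (\<lambda>l. \<Prod>j\<in>?T. k l - k j)"
    by (rule scalar_blocks_smult[symmetric])
  also have "\<dots> \<in> generated_algebra (2 * n) S"
    by (intro generated_algebra.smult prods) simp
  finally show ?thesis .
qed

text \<open>What the algebra contains in a single block position. The multiplication law of matrix units
  makes these sets compose like the morphisms of a category.\<close>

definition block_corner :: "nat \<Rightarrow> complex mat set \<Rightarrow> nat \<Rightarrow> nat \<Rightarrow> complex mat set" where
  "block_corner n S i j = {X \<in> carrier_mat 2 2. unit_block n i j X \<in> generated_algebra (2 * n) S}"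

lemma block_corner_add:
  "X \<in> block_corner n S i j \<Longrightarrow> Y \<in> block_corner n S i j \<Longrightarrow> X + Y \<in> block_corner n S i j"
  by (auto simp: block_corner_def unit_block_add[symmetric] intro: generated_algebra.add)

lemma block_corner_smult: "X \<in> block_corner n S i j \<Longrightarrow> c \<cdot>\<^sub>m X \<in> block_corner n S i j"
  by (auto simp: block_corner_def unit_block_smult[symmetric] intro: generated_algebra.smult)

lemma block_corner_mult:
  assumes "X \<in> block_corner n S i j" "Y \<in> block_corner n S j k" "j \<in> {1..n}"
  shows "X * Y \<in> block_corner n S i k"
proof -
  have X: "X \<in> carrier_mat 2 2" and Y: "Y \<in> carrier_mat 2 2"
    using assms by (auto simp: block_corner_def)
  show ?thesis
    using assms(1,2) mult_carrier_mat[OF X Y] unit_block_mult[OF X Y assms(3), of i k, symmetric]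
    by (simp add: block_corner_def generated_algebra.mult)
qed

lemma block_corner_transpose:
  assumes S: "S \<subseteq> carrier_mat (2 * n) (2 * n)"
    and sym: "\<And>M. M \<in> S \<Longrightarrow> M\<^sup>T \<in> generated_algebra (2 * n) S"
    and X: "X \<in> block_corner n S i j"
  shows "X\<^sup>T \<in> block_corner n S j i"
  using X generated_algebra_transpose[OF S sym, of "unit_block n i j X"]
  by (auto simp: block_corner_def unit_block_transpose)

text \<open>Right multiplication by an invertible matrix is surjective, so one invertible block suffices to
  carry fullness along a block row.\<close>

lemma block_corner_step:
  assumes full: "block_corner n S i j = carrier_mat 2 2"
    and h: "mat2 a b c d \<in> block_corner n S j k" and det: "a * d - b * c \<noteq> 0" and j: "j \<in> {1..n}"
  shows "block_corner n S i k = carrier_mat 2 2"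
proof
  show "block_corner n S i k \<subseteq> carrier_mat 2 2" by (auto simp: block_corner_def)
  show "carrier_mat 2 2 \<subseteq> block_corner n S i k"
  proof
    fix X :: "complex mat" assume X: "X \<in> carrier_mat 2 2"
    obtain Z where Z: "Z \<in> carrier_mat 2 2" "Z * mat2 a b c d = 1\<^sub>m 2"
      using mat2_left_inverse[OF det] by blast
    have "X * Z \<in> block_corner n S i j" using X Z(1) by (simp add: full)
    from block_corner_mult[OF this h j]
    have "(X * Z) * mat2 a b c d \<in> block_corner n S i k" .
    also have "(X * Z) * mat2 a b c d = X"
      using X Z by (simp add: assoc_mult_mat[OF X Z(1) mat2_carrier])
    finally show "X \<in> block_corner n S i k" .
  qed
qed

text \<open>Transposition turns the full first block row into a full first block column. The products of a
  column with a row are all matrices with one nonzero block, and every matrix is a sum of such.\<close>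

lemma full_generated_algebra_if_first_row_full:
  assumes S: "S \<subseteq> carrier_mat (2 * n) (2 * n)"
    and sym: "\<And>M. M \<in> S \<Longrightarrow> M\<^sup>T \<in> generated_algebra (2 * n) S"
    and row: "\<And>j. j \<in> {1..n} \<Longrightarrow> block_corner n S 1 j = carrier_mat 2 2"
  shows "generated_algebra (2 * n) S = carrier_mat (2 * n) (2 * n)"
proof
  show "generated_algebra (2 * n) S \<subseteq> carrier_mat (2 * n) (2 * n)"
    using generated_algebra_carrier[OF S] by blast
  have unit: "unit_block n i j X \<in> generated_algebra (2 * n) S"
    if X: "X \<in> carrier_mat 2 2" and i: "i \<in> {1..n}" and j: "j \<in> {1..n}" for i j X
  proof -
    have "X\<^sup>T \<in> block_corner n S 1 i" and one: "1\<^sub>m 2 \<in> block_corner n S 1 j"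
      using X row[OF i] row[OF j] by auto
    hence "X \<in> block_corner n S i 1"
      using block_corner_transpose[OF S sym, of "X\<^sup>T" 1 i] by simp
    from block_corner_mult[OF this one] i X show ?thesis
      by (simp add: block_corner_def)
  qed
  show "carrier_mat (2 * n) (2 * n) \<subseteq> generated_algebra (2 * n) S"
  proof
    fix M :: "complex mat" assume M: "M \<in> carrier_mat (2 * n) (2 * n)"
    define F where
      "F i j = mat 2 2 (\<lambda>(a, c). M $$ (2 * (i - 1) + a, 2 * (j - 1) + c))" for i j
    have F: "F i j \<in> carrier_mat 2 2" for i j by (simp add: F_def)
    have partial: "block_array n (\<lambda>i j. if (i, j) \<in> T then F i j else 0\<^sub>m 2 2)
        \<in> generated_algebra (2 * n) S"
      if "finite T" "T \<subseteq> {1..n} \<times> {1..n}" for T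
      using that
    proof induction
      case empty
      have "block_array n (\<lambda>i j. if (i, j) \<in> {} then F i j else 0\<^sub>m 2 2) = 0\<^sub>m (2 * n) (2 * n)"
        by (intro eq_matI) (auto simp: block_array_index)
      thus ?case by (simp add: generated_algebra_zero)
    next
      case (insert t T)
      obtain i0 j0 where t: "t = (i0, j0)" by fastforce
      have "block_array n (\<lambda>i j. if (i, j) \<in> insert t T then F i j else 0\<^sub>m 2 2)
          = unit_block n i0 j0 (F i0 j0) + block_array n (\<lambda>i j. if (i, j) \<in> T then F i j else 0\<^sub>m 2 2)"
        unfolding unit_block_def using insert.hyps(2) F unfolding t
        by (subst block_array_add) (auto intro!: block_array_cong)
      moreover have "unit_block n i0 j0 (F i0 j0) \<in> generated_algebra (2 * n) S"
        using insert.prems unfolding t by (intro unit F) auto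
      ultimately show ?case using insert.IH insert.prems
        by (simp add: generated_algebra.add)
    qed
    have "M = block_array n (\<lambda>i j. if (i, j) \<in> {1..n} \<times> {1..n} then F i j else 0\<^sub>m 2 2)"
      using M by (intro eq_matI)
        (auto simp: block_array_index block_index_range[simplified] F_def)
    also have "\<dots> \<in> generated_algebra (2 * n) S"
      by (rule partial) auto
    finally show "M \<in> generated_algebra (2 * n) S" .
  qed
qed

section \<open>Simultaneous block diagonalization\<close>

lemma diag_block_mat_cons_upper_zero:
  assumes "i < dim_row D" "dim_col D \<le> j" "j < dim_col (diag_block_mat (D # Ds))"
  shows "diag_block_mat (D # Ds) $$ (i, j) = 0"
  using assms by (auto simp: Let_def)

lemma mat_adjoint_carrier: "V \<in> carrier_mat N N \<Longrightarrow> mat_adjoint V \<in> carrier_mat N N"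
  by (auto simp: mat_adjoint_def)

text \<open>The matrices whose upper right block vanishes in the given unitary basis form an algebra. It
  contains the generators, but no matrix unit of the vanishing block.\<close>

lemma full_generated_algebra_not_unitarily_block_diagonal:
  assumes H: "H \<in> carrier_mat N N" and K: "K \<in> carrier_mat N N"
    and full: "generated_algebra N {H, K} = carrier_mat N N"
  shows "\<not> unitarily_block_diagonal N H K"
proof
  assume "unitarily_block_diagonal N H K"
  then obtain V ds where V: "unitary_mat N V" and len: "length ds \<ge> 2"
    and pos: "\<forall>d \<in> set ds. d > 0" and sum: "sum_list ds = N"
    and blocks: "\<And>x y. \<exists>Ms. map dim_row Ms = ds \<and> map dim_col Ms = ds \<and>
           mat_adjoint V * pencil H K x y * V = diag_block_mat Ms"
    unfolding unitarily_block_diagonal_def by blast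
  define W where "W = mat_adjoint V"
  have Vc: "V \<in> carrier_mat N N" and WV: "W * V = 1\<^sub>m N" and VW: "V * W = 1\<^sub>m N"
    using V by (auto simp: unitary_mat_def W_def)
  have Wc: "W \<in> carrier_mat N N" unfolding W_def by (rule mat_adjoint_carrier[OF Vc])
  obtain d d' ds' where ds: "ds = d # d' # ds'"
    using len by (cases ds; cases "tl ds") auto
  have d: "0 < d" "d < N" using pos sum by (auto simp: ds)
  define upper_zero where "upper_zero M \<longleftrightarrow>
    (\<forall>i j. i < d \<longrightarrow> d \<le> j \<longrightarrow> j < N \<longrightarrow> (W * M * V) $$ (i, j) = 0)" for M
  have pencil: "upper_zero (pencil H K x y)" for x y
    unfolding upper_zero_def
  proof (intro allI impI)
    fix i j assume ij: "i < d" "d \<le> j" "j < N"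
    obtain Ms where Ms: "map dim_row Ms = ds" "map dim_col Ms = ds"
      "W * pencil H K x y * V = diag_block_mat Ms"
      using blocks unfolding W_def by blast
    obtain D Ds where D: "Ms = D # Ds" using Ms(1) ds by (cases Ms) auto
    have "dim_row D = d" "dim_col D = d" using Ms ds D by auto
    moreover have "dim_col (diag_block_mat Ms) = N"
      using Ms(2) sum by (simp add: dim_diag_block_mat)
    ultimately show "(W * pencil H K x y * V) $$ (i, j) = 0"
      unfolding Ms(3) D using ij D by (intro diag_block_mat_cons_upper_zero) auto
  qed
  have HK: "upper_zero H" "upper_zero K"
  proof -
    have "pencil H K 1 0 = H" "pencil H K 0 1 = K"
      using H K by (auto simp: pencil_def intro!: eq_matI)
    thus "upper_zero H" "upper_zero K" using pencil[of 1 0] pencil[of 0 1] by auto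
  qed
  have HKc: "{H, K} \<subseteq> carrier_mat N N" using H K by auto
  have all: "upper_zero M" if "M \<in> generated_algebra N {H, K}" for M
    using that
  proof induction
    case (gen M)
    thus ?case using HK by auto
  next
    case one
    show ?case unfolding upper_zero_def using Wc WV d by auto
  next
    case (add M M')
    have c: "M \<in> carrier_mat N N" "M' \<in> carrier_mat N N"
      using add.hyps generated_algebra_carrier[OF HKc] by auto
    have "W * (M + M') * V = W * M * V + W * M' * V"
      unfolding mult_add_distrib_mat[OF Wc c]
      by (rule add_mult_distrib_mat[OF mult_carrier_mat[OF Wc c(1)] mult_carrier_mat[OF Wc c(2)] Vc])
    thus ?case using add.IH Wc Vc c d unfolding upper_zero_def by auto
  next
    case (smult M s)
    have c: "M \<in> carrier_mat N N"
      using smult.hyps generated_algebra_carrier[OF HKc] by auto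
    have "W * (s \<cdot>\<^sub>m M) * V = s \<cdot>\<^sub>m (W * M * V)"
      unfolding mult_smult_distrib[OF Wc c] mult_smult_assoc_mat[OF mult_carrier_mat[OF Wc c] Vc] ..
    thus ?case using smult.IH Wc Vc c d unfolding upper_zero_def by auto
  next
    case (mult M M')
    have c: "M \<in> carrier_mat N N" "M' \<in> carrier_mat N N"
      using mult.hyps generated_algebra_carrier[OF HKc] by auto
    define P where "P = W * M * V"
    define Q where "Q = W * M' * V"
    have PQ: "P \<in> carrier_mat N N" "Q \<in> carrier_mat N N"
      using Wc Vc c unfolding P_def Q_def by auto
    have "P * Q = W * M * (V * W) * M' * V"
      unfolding P_def Q_def using Wc Vc c by (simp add: assoc_mult_mat[of _ N N _ N _ N])
    also have "\<dots> = W * (M * M') * V"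
      unfolding VW using Wc Vc c by (simp add: assoc_mult_mat[of _ N N _ N _ N])
    finally have eq: "W * (M * M') * V = P * Q" by simp
    show ?case unfolding upper_zero_def eq
    proof (intro allI impI)
      fix i j assume ij: "i < d" "d \<le> j" "j < N"
      have "P $$ (i, k) * Q $$ (k, j) = 0" if "k < N" for k
        using mult.IH ij that unfolding upper_zero_def P_def[symmetric] Q_def[symmetric]
        by (cases "k < d") auto
      hence "(\<Sum>k = 0..<N. P $$ (i, k) * Q $$ (k, j)) = 0" by (intro sum.neutral) auto
      thus "(P * Q) $$ (i, j) = 0"
        using PQ ij d by (simp add: scalar_prod_def)
    qed
  qed
  \<comment> \<open>\<open>V E W\<close> has a nonzero entry in the upper right block with respect to the basis \<open>V\<close>.\<close>
  define E where "E = mat N N (\<lambda>(i, j). if i = 0 \<and> j = d then 1 else 0 :: complex)"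
  have E: "E \<in> carrier_mat N N" by (simp add: E_def)
  have "W * (V * E * W) * V = (W * V) * E * (W * V)"
    using Wc Vc E by (simp add: assoc_mult_mat[of _ N N _ N _ N])
  also have "\<dots> = E" unfolding WV using E by simp
  finally have "W * (V * E * W) * V = E" .
  moreover have "upper_zero (V * E * W)"
    using all full Wc Vc E by auto
  ultimately have "E $$ (0, d) = 0" using d by (auto simp: upper_zero_def)
  thus False using d by (simp add: E_def)
qed

section \<open>The blocks of the two generators\<close>

lemma A_block_carrier [simp]: "A_block b n i j \<in> carrier_mat 2 2"
  by (auto simp: A_block_def alpha_mat_def beta_mat_def U_mat_def mat2_linear)

lemma U_mat_carrier [simp]: "U_mat \<in> carrier_mat 2 2"
  by (simp add: U_mat_def)

lemma A_block_skew: "(A_block b n j i)\<^sup>T = - A_block b n i j"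
  by (auto simp: A_block_def alpha_mat_def beta_mat_def U_mat_def mat2_linear)

text \<open>The matrix \<open>U\<close> anticommutes with the reflections \<open>\<alpha>\<close> and \<open>\<beta>\<close>, which span the off-diagonal blocks of
  \<open>A\<close>, and \<open>U\<^sup>2 = - I\<close>.\<close>

lemma A_block_anticommutator:
  "A_block b n i j * U_mat + U_mat * A_block b n i j
    = (if i = j then (- 2 * (q_val n + real i - 1)) \<cdot>\<^sub>m 1\<^sub>m 2 else 0\<^sub>m 2 2)"
  by (auto simp: A_block_def alpha_mat_def beta_mat_def U_mat_def mat2_linear mat2_mult algebra_simps)

lemma A_mat_carrier: "A_mat b n \<in> carrier_mat (2 * n) (2 * n)"
  by (simp add: A_mat_def)

lemma A_mat_skew: "(A_mat b n)\<^sup>T = - A_mat b n"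
  unfolding A_mat_def by (simp add: block_array_transpose block_array_uminus A_block_skew)

lemma B_mat_block_diagonal: "B_mat n = block_diagonal n (\<lambda>_. U_mat)"
  by (simp add: B_mat_def block_diagonal_def)

lemma B_mat_carrier: "B_mat n \<in> carrier_mat (2 * n) (2 * n)"
  by (simp add: B_mat_def)

lemma B_mat_skew: "(B_mat n)\<^sup>T = - B_mat n"
  unfolding B_mat_def
  by (subst block_array_transpose, simp, subst block_array_uminus, simp, rule block_array_cong)
     (simp add: U_mat_def mat2_linear)

lemma B_mat_square: "B_mat n * B_mat n = - 1\<^sub>m (2 * n)"
proof -
  have "B_mat n * B_mat n = block_array n (\<lambda>i j. U_mat * (if i = j then U_mat else 0\<^sub>m 2 2))"
    unfolding B_mat_block_diagonal block_diagonal_def[of n "\<lambda>_. U_mat"]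
    using block_diagonal_mult_left[of "\<lambda>_. U_mat" "\<lambda>i j. if i = j then U_mat else 0\<^sub>m 2 2" n]
    by (simp add: block_diagonal_def)
  also have "\<dots> = - block_diagonal n (\<lambda>_. 1\<^sub>m 2)"
    unfolding block_diagonal_def
    by (subst block_array_uminus, simp, rule block_array_cong)
       (simp add: U_mat_def mat2_linear mat2_mult)
  finally show ?thesis by (simp add: block_diagonal_one)
qed

lemma anticommutator_scalar_blocks:
  "A_mat b n * B_mat n + B_mat n * A_mat b n = scalar_blocks n (\<lambda>i. - 2 * (q_val n + real i - 1))"
proof -
  have "A_mat b n * B_mat n + B_mat n * A_mat b n
      = block_array n (\<lambda>i j. A_block b n i j * U_mat) + block_array n (\<lambda>i j. U_mat * A_block b n i j)"
    unfolding A_mat_def B_mat_block_diagonal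
    by (simp add: block_diagonal_mult_left block_diagonal_mult_right)
  also have "\<dots> = block_array n (\<lambda>i j. A_block b n i j * U_mat + U_mat * A_block b n i j)"
    by (rule block_array_add) (auto intro: mult_carrier_mat[of _ 2 2 _ 2])
  also have "\<dots> = scalar_blocks n (\<lambda>i. - 2 * (q_val n + real i - 1))"
    unfolding scalar_blocks_def block_diagonal_def A_block_anticommutator ..
  finally show ?thesis .
qed

lemma K_mat_scalar_blocks:
  "K_mat b n = scalar_blocks n (\<lambda>i. complex_of_real (- 2 * (q_val n + real i - 1)))"
  unfolding K_mat_def anticommutator_scalar_blocks scalar_blocks_def block_diagonal_def
  by (subst block_array_map, simp, rule block_array_cong) (auto simp: mat2_linear map_mat_mat2)

definition H_block :: "real \<Rightarrow> nat \<Rightarrow> nat \<Rightarrow> nat \<Rightarrow> complex mat" where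
  "H_block b n i j
    = map_mat complex_of_real (block_sum {1..n} (\<lambda>k. A_block b n i k * A_block b n k j))"

lemma H_mat_block_array: "H_mat b n = block_array n (H_block b n)"
  unfolding H_mat_def A_mat_def H_block_def
  by (simp add: block_array_mult block_array_map)

lemma H_block_carrier [simp]: "H_block b n i j \<in> carrier_mat 2 2"
  by (simp add: H_block_def)

text \<open>Block column \<open>j\<close> of \<open>A\<close> is supported in the first four block rows. The trailing zero
  matches the recursive evaluation of the sum.\<close>

lemma A_product_block_upto_4:
  assumes n: "n \<ge> 4" and j: "j \<in> {2, 3, 4}"
  shows "block_sum {1..n} (\<lambda>k. A_block b n i k * A_block b n k j)
    = A_block b n i 1 * A_block b n 1 j + (A_block b n i 2 * A_block b n 2 j
      + (A_block b n i 3 * A_block b n 3 j + (A_block b n i 4 * A_block b n 4 j + 0\<^sub>m 2 2)))"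
proof -
  have "block_sum {1..n} (\<lambda>k. A_block b n i k * A_block b n k j)
      = block_sum {1, 2, 3, 4} (\<lambda>k. A_block b n i k * A_block b n k j)"
  proof (rule block_sum_restrict)
    fix k assume "k \<in> {1..n} - {1, 2, 3, 4}"
    hence "A_block b n k j = 0\<^sub>m 2 2"
      using j by (auto simp: A_block_def)
    thus "A_block b n i k * A_block b n k j = 0\<^sub>m 2 2"
      using right_mult_zero_mat[OF A_block_carrier] by simp
  qed (use n in auto)
  also have "\<dots> = A_block b n i 1 * A_block b n 1 j + (A_block b n i 2 * A_block b n 2 j
      + (A_block b n i 3 * A_block b n 3 j + (A_block b n i 4 * A_block b n 4 j + 0\<^sub>m 2 2)))"
    by (simp add: block_sum_insert mult_carrier_mat[of _ 2 2 _ 2] del: One_nat_def)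
  finally show ?thesis .
qed

lemma A_product_block_far:
  assumes j: "j \<in> {1..n}" "j \<ge> 5"
  shows "block_sum {1..n} (\<lambda>k. A_block b n i k * A_block b n k j)
    = A_block b n i 1 * A_block b n 1 j + (A_block b n i j * A_block b n j j + 0\<^sub>m 2 2)"
proof -
  have "block_sum {1..n} (\<lambda>k. A_block b n i k * A_block b n k j)
      = block_sum {1, j} (\<lambda>k. A_block b n i k * A_block b n k j)"
  proof (rule block_sum_restrict)
    fix k assume "k \<in> {1..n} - {1, j}"
    hence "A_block b n k j = 0\<^sub>m 2 2"
      using j by (auto simp: A_block_def)
    thus "A_block b n i k * A_block b n k j = 0\<^sub>m 2 2"
      using right_mult_zero_mat[OF A_block_carrier] by simp
  qed (use j in auto)
  also have "\<dots> = A_block b n i 1 * A_block b n 1 j + (A_block b n i j * A_block b n j j + 0\<^sub>m 2 2)"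
    using j by (simp add: block_sum_insert mult_carrier_mat[of _ 2 2 _ 2] del: One_nat_def)
  finally show ?thesis .
qed

text \<open>Every value in this list but the second is invertible for all \<open>b \<noteq> 0\<close>. The block \<open>(1,4)\<close>
  serves to produce \<open>\<beta>\<close>. The block \<open>(1,3)\<close> has determinant
  \<open>b\<^sup>2 - 3\<close>, which is why the third block column is reached from the second one instead.\<close>

lemma H_block_values:
  assumes n: "n \<ge> 4"
  shows "H_block b n 1 2 = mat2 (- 2 * b) (- 2) 0 (- 2 * b)"
    and "H_block b n 1 4 = mat2 b (- 3) (- 3) b"
    and "H_block b n 2 3 = mat2 0 (- b) (- b) (- 2)"
    and "H_block b n 3 4 = mat2 (- (1 + b * b)) b (- b) (- (1 + b * b))"
  unfolding H_block_def
  by (subst A_product_block_upto_4[OF n], simp, simp add: A_block_def alpha_mat_def beta_mat_def U_mat_def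
      mat2_linear mat2_mult map_mat_mat2 algebra_simps)+

lemma H_block_far:
  assumes j: "j \<in> {1..n}" "j \<ge> 5"
  shows "H_block b n 1 j = mat2 0 (1 - of_nat j) (1 - of_nat j) 0"
  unfolding H_block_def A_product_block_far[OF assms] using j
  by (simp add: A_block_def alpha_mat_def beta_mat_def U_mat_def
      mat2_linear mat2_mult map_mat_mat2 algebra_simps)

lemma A_mat_square_transpose: "(A_mat b n * A_mat b n)\<^sup>T = A_mat b n * A_mat b n"
proof -
  have "(A_mat b n * A_mat b n)\<^sup>T = (- A_mat b n) * (- A_mat b n)"
    using transpose_mult[OF A_mat_carrier A_mat_carrier] by (simp add: A_mat_skew)
  also have "\<dots> = A_mat b n * A_mat b n"
    using A_mat_carrier[of b n] by (intro eq_matI) (auto simp: scalar_prod_def)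
  finally show ?thesis .
qed

lemma H_mat_transpose: "(H_mat b n)\<^sup>T = H_mat b n"
  by (simp add: H_mat_def map_mat_transpose A_mat_square_transpose)

lemma K_mat_transpose: "(K_mat b n)\<^sup>T = K_mat b n"
  unfolding K_mat_scalar_blocks by (rule scalar_blocks_transpose)

lemma H_mat_carrier: "H_mat b n \<in> carrier_mat (2 * n) (2 * n)"
  by (simp add: H_mat_block_array)

lemma K_mat_carrier: "K_mat b n \<in> carrier_mat (2 * n) (2 * n)"
  by (simp add: K_mat_scalar_blocks scalar_blocks_carrier)

section \<open>The two generators generate the full matrix algebra\<close>

lemma unit_block_one_in_generated_algebra:
  assumes i: "i \<in> {1..n}"
  shows "unit_block n i i (1\<^sub>m 2) \<in> generated_algebra (2 * n) {H_mat b n, K_mat b n}"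
  unfolding unit_block_one
proof (rule block_projection_in_generated_algebra[OF _ _ i])
  show "inj_on (\<lambda>i. complex_of_real (- 2 * (q_val n + real i - 1))) {1..n}"
    by (auto simp: inj_on_def)
  show "scalar_blocks n (\<lambda>i. complex_of_real (- 2 * (q_val n + real i - 1)))
      \<in> generated_algebra (2 * n) {H_mat b n, K_mat b n}"
    unfolding K_mat_scalar_blocks[of b n, symmetric] by (rule generated_algebra.gen) simp
qed

text \<open>The block projections are polynomials in \<open>K\<close>, whose diagonal blocks are distinct multiples of the
  identity.\<close>

lemma H_block_in_block_corner:
  assumes i: "i \<in> {1..n}" and j: "j \<in> {1..n}"
  shows "H_block b n i j \<in> block_corner n {H_mat b n, K_mat b n} i j"
proof -
  let ?G = "generated_algebra (2 * n) {H_mat b n, K_mat b n}"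
  have "H_mat b n \<in> ?G" by (intro generated_algebra.gen) auto
  hence "unit_block n i i (1\<^sub>m 2) * H_mat b n * unit_block n j j (1\<^sub>m 2) \<in> ?G"
    by (intro generated_algebra.mult unit_block_one_in_generated_algebra i j)
  thus ?thesis
    unfolding H_mat_block_array unit_block_one scalar_blocks_def
      unit_block_compression[OF H_block_carrier]
    by (simp add: block_corner_def)
qed

text \<open>Let \<open>h\<^sub>j\<close> be the block \<open>(1,j)\<close> of \<open>H\<close>. Then \<open>h\<^sub>4 h\<^sub>4\<^sup>T = (b\<^sup>2 + 9) I - 6 b \<beta>\<close> provides \<open>\<beta>\<close> since
  \<open>b \<noteq> 0\<close>, and \<open>h\<^sub>2 h\<^sub>2\<^sup>T = (4 b\<^sup>2 + 2) I + 4 b \<beta> + 2 \<alpha>\<close> then provides \<open>\<alpha>\<close>. The matrices \<open>\<alpha>\<close> and \<open>\<beta>\<close>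
  generate all matrices of order two.\<close>

lemma block_corner_1_1_full:
  assumes b: "b \<noteq> 0" and n: "n \<ge> 4"
  shows "block_corner n {H_mat b n, K_mat b n} 1 1 = carrier_mat 2 2"
proof -
  let ?S = "{H_mat b n, K_mat b n}"
  let ?C = "block_corner n ?S 1 1"
  have S: "?S \<subseteq> carrier_mat (2 * n) (2 * n)"
    using H_mat_carrier K_mat_carrier by auto
  have sym: "M\<^sup>T \<in> generated_algebra (2 * n) ?S" if "M \<in> ?S" for M
    using that by (auto simp: H_mat_transpose K_mat_transpose intro: generated_algebra.gen)
  have HHt: "H_block b n 1 j * (H_block b n 1 j)\<^sup>T \<in> ?C" if "j \<in> {1..n}" for j
    using n that by (intro block_corner_mult[of _ n ?S 1 j] block_corner_transpose[OF S sym]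
        H_block_in_block_corner) auto
  have one: "mat2 1 0 0 1 \<in> ?C"
    using unit_block_one_in_generated_algebra[of 1 n b] n
    by (simp add: block_corner_def mat2_linear(6)[symmetric])
  let ?b = "complex_of_real b"
  have b': "?b \<noteq> 0" using b by simp
  have combine: "s \<cdot>\<^sub>m X + (t \<cdot>\<^sub>m Y + u \<cdot>\<^sub>m Z) \<in> ?C"
    if "X \<in> ?C" "Y \<in> ?C" "Z \<in> ?C" for s t u X Y Z
    using that by (intro block_corner_add block_corner_smult)
  have P4: "mat2 (?b * ?b + 9) (- 6 * ?b) (- 6 * ?b) (?b * ?b + 9) \<in> ?C"
    using HHt[of 4] n unfolding H_block_values[OF n] mat2_linear mat2_mult
    by (simp add: algebra_simps)
  have P2: "mat2 (4 * (?b * ?b) + 4) (4 * ?b) (4 * ?b) (4 * (?b * ?b)) \<in> ?C"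
    using HHt[of 2] n unfolding H_block_values[OF n] mat2_linear mat2_mult
    by (simp add: algebra_simps)
  have beta: "mat2 0 1 1 0 \<in> ?C"
  proof -
    have "(- 1 / (6 * ?b)) \<cdot>\<^sub>m mat2 (?b * ?b + 9) (- 6 * ?b) (- 6 * ?b) (?b * ?b + 9)
        + (((?b * ?b + 9) / (6 * ?b)) \<cdot>\<^sub>m mat2 1 0 0 1 + 0 \<cdot>\<^sub>m mat2 1 0 0 1) = mat2 0 1 1 0"
      unfolding mat2_linear using b' by (simp add: field_simps)
    thus ?thesis using combine[OF P4 one one] by metis
  qed
  \<comment> \<open>The projection \<open>(I + \<alpha>) / 2\<close> is obtained directly; it serves in place of \<open>\<alpha>\<close>.\<close>
  have E11: "mat2 1 0 0 0 \<in> ?C"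
  proof -
    have "(1 / 4) \<cdot>\<^sub>m mat2 (4 * (?b * ?b) + 4) (4 * ?b) (4 * ?b) (4 * (?b * ?b))
        + ((- (?b * ?b)) \<cdot>\<^sub>m mat2 1 0 0 1 + (- ?b) \<cdot>\<^sub>m mat2 0 1 1 0) = mat2 1 0 0 0"
      unfolding mat2_linear by (simp add: field_simps)
    thus ?thesis using combine[OF P2 one beta] by metis
  qed
  have one_in: "1 \<in> {1..n}" using n by auto
  have E12: "mat2 0 1 0 0 \<in> ?C"
    using block_corner_mult[OF E11 beta one_in] by (simp add: mat2_mult)
  have E21: "mat2 0 0 1 0 \<in> ?C"
    using block_corner_mult[OF beta E11 one_in] by (simp add: mat2_mult)
  have E22: "mat2 0 0 0 1 \<in> ?C"
    using block_corner_mult[OF E21 E12 one_in] by (simp add: mat2_mult)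
  show ?thesis
  proof
    show "?C \<subseteq> carrier_mat 2 2" by (auto simp: block_corner_def)
    show "carrier_mat 2 2 \<subseteq> ?C"
    proof
      fix X :: "complex mat" assume X: "X \<in> carrier_mat 2 2"
      have "X = X $$ (0, 0) \<cdot>\<^sub>m mat2 1 0 0 0 + (X $$ (0, 1) \<cdot>\<^sub>m mat2 0 1 0 0
          + (X $$ (1, 0) \<cdot>\<^sub>m mat2 0 0 1 0 + X $$ (1, 1) \<cdot>\<^sub>m mat2 0 0 0 1))"
        unfolding mat2_linear using X by (intro mat2_eqI) auto
      thus "X \<in> ?C"
        using block_corner_add[OF block_corner_smult[OF E11] block_corner_add[OF
            block_corner_smult[OF E12] block_corner_add[OF block_corner_smult[OF E21]
            block_corner_smult[OF E22]]]] by metis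
    qed
  qed
qed

text \<open>Fullness spreads from the position \<open>(1,1)\<close> along the path of block indices \<open>1, 2, 3, 4\<close> and from \<open>1\<close>
  to each \<open>j \<ge> 5\<close>. The blocks on the way have the determinants \<open>4 b\<^sup>2\<close>, \<open>- b\<^sup>2\<close>, \<open>(1 + b\<^sup>2)\<^sup>2 + b\<^sup>2\<close> and
  \<open>- (j - 1)\<^sup>2\<close>, none of which vanishes.\<close>

theorem H_K_generate_full_algebra:
  assumes b: "b \<noteq> 0" and n: "n \<ge> 4"
  shows "generated_algebra (2 * n) {H_mat b n, K_mat b n} = carrier_mat (2 * n) (2 * n)"
proof (rule full_generated_algebra_if_first_row_full)
  let ?S = "{H_mat b n, K_mat b n}"
  let ?b = "complex_of_real b"
  show "?S \<subseteq> carrier_mat (2 * n) (2 * n)"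
    using H_mat_carrier K_mat_carrier by auto
  show "M\<^sup>T \<in> generated_algebra (2 * n) ?S" if "M \<in> ?S" for M
    using that by (auto simp: H_mat_transpose K_mat_transpose intro: generated_algebra.gen)
  fix j assume j: "j \<in> {1..n}"
  note h = H_block_in_block_corner[where b = b and n = n]
  note full1 = block_corner_1_1_full[OF b n]
  have full2: "block_corner n ?S 1 2 = carrier_mat 2 2"
    using h[of 1 2] n b unfolding H_block_values[OF n]
    by (intro block_corner_step[OF full1]) auto
  have full3: "block_corner n ?S 1 3 = carrier_mat 2 2"
    using h[of 2 3] n b unfolding H_block_values[OF n]
    by (intro block_corner_step[OF full2]) auto
  have "(1 + b * b) * (1 + b * b) + b * b > 0"
    by (intro add_pos_nonneg mult_pos_pos) (auto intro: add_pos_nonneg)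
  hence "complex_of_real ((1 + b * b) * (1 + b * b) + b * b) \<noteq> 0"
    unfolding of_real_eq_0_iff by (rule less_imp_neq[symmetric])
  hence det4: "- (1 + ?b * ?b) * - (1 + ?b * ?b) - ?b * - ?b \<noteq> 0"
    by (simp add: algebra_simps)
  have full4: "block_corner n ?S 1 4 = carrier_mat 2 2"
    using h[of 3 4] n unfolding H_block_values[OF n]
    by (intro block_corner_step[OF full3 _ det4]) auto
  show "block_corner n ?S 1 j = carrier_mat 2 2"
  proof (cases "j \<ge> 5")
    case True
    have "(of_nat j :: complex) \<noteq> of_nat 1"
      using True unfolding of_nat_eq_iff by simp
    hence "(1 - of_nat j :: complex) \<noteq> 0" by simp
    thus ?thesis
      using h[of 1 j] n j unfolding H_block_far[OF j True]
      by (intro block_corner_step[OF full1]) auto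
  next
    case False
    hence "j = 1 \<or> j = 2 \<or> j = 3 \<or> j = 4" using j by auto
    thus ?thesis using full1 full2 full3 full4 by auto
  qed
qed

section \<open>Even multiplicities\<close>

text \<open>\<open>det_pencil_square\<close> over \<open>\<complex>[s][t]\<close>, for the images of the real matrices \<open>A\<close> and \<open>B\<close> as constants.
  The parameters \<open>w\<close>, \<open>p\<close> and \<open>y\<close> are left open because the characteristic polynomial and the
  pencil polynomial use the two indeterminates differently.\<close>

lemma det_const_pencil_square:
  fixes p y w :: "complex poly poly"
  assumes p: "prime_elem p"
  shows "\<exists>g. det (w \<cdot>\<^sub>m 1\<^sub>m (2 * n) + p \<cdot>\<^sub>m map_mat (\<lambda>c. [:[:c:]:]) (H_mat b n)
      + y \<cdot>\<^sub>m map_mat (\<lambda>c. [:[:c:]:]) (K_mat b n)) = g\<^sup>2"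
proof -
  interpret f: comm_ring_hom "\<lambda>c. [:[:complex_of_real c:]:]"
    by standard (auto simp: one_pCons)
  let ?f = "map_mat (\<lambda>c. [:[:complex_of_real c:]:])"
  note A = A_mat_carrier[of b n] and B = B_mat_carrier[of n]
  have H: "map_mat (\<lambda>c. [:[:c:]:]) (H_mat b n) = ?f (A_mat b n) * ?f (A_mat b n)"
    unfolding f.mat_hom_mult[OF A A, symmetric] by (intro eq_matI) (auto simp: H_mat_def)
  have K: "map_mat (\<lambda>c. [:[:c:]:]) (K_mat b n)
      = ?f (A_mat b n) * ?f (B_mat n) + ?f (B_mat n) * ?f (A_mat b n)"
    unfolding f.mat_hom_mult[OF A B, symmetric] f.mat_hom_mult[OF B A, symmetric]
    using A B by (intro eq_matI) (auto simp: K_mat_def)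
  show ?thesis unfolding H K
  proof (rule det_pencil_square[OF _ _ _ _ _ p])
    show "(?f (A_mat b n))\<^sup>T = - ?f (A_mat b n)" "(?f (B_mat n))\<^sup>T = - ?f (B_mat n)"
      unfolding map_mat_transpose A_mat_skew B_mat_skew by (auto intro!: eq_matI)
    show "?f (B_mat n) * ?f (B_mat n) = - 1\<^sub>m (2 * n)"
      unfolding f.mat_hom_mult[OF B B, symmetric] B_mat_square f.mat_hom_one[symmetric]
      by (intro eq_matI) (auto simp: f.hom_uminus)
  qed (use A B in auto)
qed

text \<open>The inner indeterminate is that of the characteristic polynomial. The outer one
  perturbs \<open>- x\<close>, which makes the coefficient of \<open>H\<close> prime even if \<open>x = 0\<close>.\<close>

lemma char_poly_pencil_square: "\<exists>r. char_poly (pencil (H_mat b n) (K_mat b n) x y) = r\<^sup>2"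
proof -
  let ?x = "[:- [:complex_of_real x:], 1:]" and ?y = "[:[:- complex_of_real y:]:]"
  let ?D = "[:[:0, 1:]:] \<cdot>\<^sub>m 1\<^sub>m (2 * n) + ?x \<cdot>\<^sub>m map_mat (\<lambda>c. [:[:c:]:]) (H_mat b n)
      + ?y \<cdot>\<^sub>m map_mat (\<lambda>c. [:[:c:]:]) (K_mat b n)"
  obtain g where g: "det ?D = g\<^sup>2"
    using det_const_pencil_square[OF prime_elem_monic_linear_poly] by blast
  have "poly (det ?D) 0 = char_poly (pencil (H_mat b n) (K_mat b n) x y)"
    unfolding char_poly_def using H_mat_carrier[of b n] K_mat_carrier[of b n]
    by (intro poly_det_cong[of _ "2 * n"]) (auto simp: char_poly_matrix_def pencil_def)
  thus ?thesis unfolding g by (metis poly_power)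
qed

lemma pencil_poly_square: "\<exists>g. pencil_poly (2 * n) (H_mat b n) (K_mat b n) = g\<^sup>2"
proof -
  have "prime_elem [:[:0, 1 :: complex:]:]"
    using lift_prime_elem_poly[OF prime_elem_monic_linear_poly[of 0]] by simp
  from det_const_pencil_square[OF this, of 1 n b "[:0, 1:]"]
  obtain g where g: "det (1 \<cdot>\<^sub>m 1\<^sub>m (2 * n) + [:[:0, 1:]:] \<cdot>\<^sub>m map_mat (\<lambda>c. [:[:c:]:]) (H_mat b n)
      + [:0, 1:] \<cdot>\<^sub>m map_mat (\<lambda>c. [:[:c:]:]) (K_mat b n)) = g\<^sup>2" by blast
  have "pencil_poly (2 * n) (H_mat b n) (K_mat b n) = g\<^sup>2"
    unfolding g[symmetric] pencil_poly_def using H_mat_carrier[of b n] K_mat_carrier[of b n]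
    by (intro arg_cong[of _ _ det] eq_matI) (auto simp: add_ac)
  thus ?thesis by blast
qed

section \<open>The counterexample\<close>

lemma hermitian_of_real_symmetric:
  assumes "M \<in> carrier_mat N N" "M\<^sup>T = M"
  shows "hermitian_mat N (map_mat complex_of_real M)"
proof -
  have "mat_adjoint (map_mat complex_of_real M) = map_mat complex_of_real (M\<^sup>T)"
    using assms(1) by (intro eq_matI) (auto simp: mat_adjoint_def mat_of_rows_index)
  thus ?thesis using assms by (simp add: hermitian_mat_def)
qed

theorem theorem2:
  fixes b :: real and n :: nat
  assumes "b \<noteq> 0" and "n \<ge> 4"
  shows "(\<forall>x y :: real. \<forall>e :: complex.
            eigenvalue (pencil (H_mat b n) (K_mat b n) x y) e \<longrightarrow>
            even (order e (char_poly (pencil (H_mat b n) (K_mat b n) x y))))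
       \<and> generated_algebra (2 * n) {H_mat b n, K_mat b n} = carrier_mat (2 * n) (2 * n)
       \<and> \<not> kippenhahn_conjecture_for n (H_mat b n) (K_mat b n)"
proof (intro conjI allI impI)
  fix x y :: real and e :: complex
  let ?L = "pencil (H_mat b n) (K_mat b n) x y"
  obtain r where r: "char_poly ?L = r\<^sup>2" using char_poly_pencil_square by blast
  have "?L \<in> carrier_mat (2 * n) (2 * n)"
    using H_mat_carrier K_mat_carrier by (auto simp: pencil_def)
  hence "coeff (char_poly ?L) (2 * n) = 1" using degree_monic_char_poly by blast
  hence "r * r \<noteq> 0" unfolding r power2_eq_square by (metis coeff_0 zero_neq_one)
  from order_mult[OF this] show "even (order e (char_poly ?L))"
    unfolding r power2_eq_square by simp
next
  show full: "generated_algebra (2 * n) {H_mat b n, K_mat b n} = carrier_mat (2 * n) (2 * n)"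
    by (rule H_K_generate_full_algebra[OF assms])
  have "hermitian_mat (2 * n) (H_mat b n)"
    unfolding H_mat_def using A_mat_carrier[of b n]
    by (intro hermitian_of_real_symmetric A_mat_square_transpose) auto
  moreover have "hermitian_mat (2 * n) (K_mat b n)"
    unfolding K_mat_def using A_mat_carrier[of b n] B_mat_carrier[of n]
    by (intro hermitian_of_real_symmetric)
       (auto simp: anticommutator_scalar_blocks scalar_blocks_transpose scalar_blocks_carrier)
  ultimately show "\<not> kippenhahn_conjecture_for n (H_mat b n) (K_mat b n)"
    using pencil_poly_square[of n b]
      full_generated_algebra_not_unitarily_block_diagonal[OF H_mat_carrier K_mat_carrier full]
    unfolding kippenhahn_conjecture_for_def kippenhahn_hypothesis_def by blast
qed

end
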